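(* Let $\mathcal{H}$ be a reproducing kernel Hilbert space on a non-empty set $\Omega$, and let $A,B\in\mathcal{B}(\mathcal{H})$. Then $$\|A+B\|^2_{ber}\leq \|A\|^2_{ber}+\|B\|^2_{ber}+\frac{1}{2}\mathbf{ber}(A^*A+B^*B)+\mathbf{ber}(A^*B)$$ and $$\|A+B\|^2_{ber}\leq \|A\|^2_{ber}+\|B\|^2_{ber}+\frac{1}{2}\mathbf{ber}(AA^*+BB^* )+\mathbf{ber}(AB^* ).$$
   Context: Let $\mathbb{F}$ be $\mathbb{R}$ or $\mathbb{C}$ and $\Omega$ a non-empty set. A reproducing kernel Hilbert space $\mathcal{H}$ on $\Omega$ is a Hilbert space over $\mathbb{F}$ consisting of functions $\Omega\to\mathbb{F}$ such that every evaluation $f\mapsto f(\lambda)$, $\lambda\in\Omega$, is bounded. For $\lambda\in\Omega$, $k_\lambda\in\mathcal{H}$ is the unique vector with $f(\lambda)=\langle f,k_\lambda\rangle$ for all $f\in\mathcal{H}$; it is assumed that $k_\lambda\neq 0$ for every $\lambda$, and $\hat{k}_\lambda=k_\lambda/\|k_\lambda\|$. $\mathcal{B}(\mathcal{H})$ is the set of bounded linear operators on $\mathcal{H}$. For $A\in\mathcal{B}(\mathcal{H})$, the Berezin number is $\mathbf{ber}(A)=\sup_{\lambda\in\Omega}|\langle A\hat{k}_\lambda,\hat{k}_\lambda\rangle|$ and the Berezin norm is $\|A\|_{ber}=\sup_{\lambda,\mu\in\Omega}|\langle A\hat{k}_\lambda,\hat{k}_\mu\rangle|$. *)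

theory Defs
  imports Complex_Main "HOL-Library.Function_Algebras"
begin

text \<open>
  Both scalar fields are treated at once: the field \<open>F\<close> is either the set of real numbers or all
  of the complex numbers, in both cases as a set of complex numbers, so that complex conjugation
  restricts to the conjugation of \<open>F\<close> (the identity in the real case).
  Sums, differences and the zero of functions are pointwise (\<^theory>\<open>HOL-Library.Function_Algebras\<close>).
\<close>

locale hilbert_function_space =
  fixes F :: "complex set"
    and X :: "'a set"
    and H :: "('a \<Rightarrow> complex) set"
    and ip :: "('a \<Rightarrow> complex) \<Rightarrow> ('a \<Rightarrow> complex) \<Rightarrow> complex"
  assumes scalars: "F = \<real> \<or> F = UNIV"
    and nonempty: "X \<noteq> {}"
    and scalar_valued: "\<And>f x. f \<in> H \<Longrightarrow> x \<in> X \<Longrightarrow> f x \<in> F"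
    \<comment> \<open>a function on \<open>X\<close> is represented by its extension by zero\<close>
    and off_domain: "\<And>f x. f \<in> H \<Longrightarrow> x \<notin> X \<Longrightarrow> f x = 0"
    and zero_mem: "0 \<in> H"
    and add_mem: "\<And>f g. f \<in> H \<Longrightarrow> g \<in> H \<Longrightarrow> f + g \<in> H"
    and scale_mem: "\<And>c f. c \<in> F \<Longrightarrow> f \<in> H \<Longrightarrow> (\<lambda>x. c * f x) \<in> H"
    and ip_mem: "\<And>f g. f \<in> H \<Longrightarrow> g \<in> H \<Longrightarrow> ip f g \<in> F"
    and ip_add: "\<And>f g h. f \<in> H \<Longrightarrow> g \<in> H \<Longrightarrow> h \<in> H \<Longrightarrow> ip (f + g) h = ip f h + ip g h"
    and ip_scale: "\<And>c f g. c \<in> F \<Longrightarrow> f \<in> H \<Longrightarrow> g \<in> H \<Longrightarrow> ip (\<lambda>x. c * f x) g = c * ip f g"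
    and ip_commute: "\<And>f g. f \<in> H \<Longrightarrow> g \<in> H \<Longrightarrow> ip g f = cnj (ip f g)"
    and ip_nonneg: "\<And>f. f \<in> H \<Longrightarrow> 0 \<le> Re (ip f f)"
    and ip_definite: "\<And>f. f \<in> H \<Longrightarrow> ip f f = 0 \<Longrightarrow> f = 0"
    and complete: "\<And>u :: nat \<Rightarrow> 'a \<Rightarrow> complex.
      (\<And>n. u n \<in> H) \<Longrightarrow>
      (\<And>e. e > 0 \<Longrightarrow> \<exists>N. \<forall>m\<ge>N. \<forall>n\<ge>N. sqrt (Re (ip (u m - u n) (u m - u n))) < e) \<Longrightarrow>
      \<exists>f\<in>H. (\<lambda>n. sqrt (Re (ip (u n - f) (u n - f)))) \<longlonglongrightarrow> 0"
begin

definition hnorm :: "('a \<Rightarrow> complex) \<Rightarrow> real" where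
  "hnorm f = sqrt (Re (ip f f))"

text \<open>
  An operator on \<open>H\<close> is a function on the whole type of which only the values on \<open>H\<close> matter.
\<close>

definition bounded_ops :: "(('a \<Rightarrow> complex) \<Rightarrow> ('a \<Rightarrow> complex)) set" where
  "bounded_ops = {A.
     (\<forall>f\<in>H. A f \<in> H) \<and>
     (\<forall>f\<in>H. \<forall>g\<in>H. A (f + g) = A f + A g) \<and>
     (\<forall>c\<in>F. \<forall>f\<in>H. A (\<lambda>x. c * f x) = (\<lambda>x. c * A f x)) \<and>
     (\<exists>C. \<forall>f\<in>H. hnorm (A f) \<le> C * hnorm f)}"

definition adj :: "(('a \<Rightarrow> complex) \<Rightarrow> ('a \<Rightarrow> complex)) \<Rightarrow> ('a \<Rightarrow> complex) \<Rightarrow> ('a \<Rightarrow> complex)" where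
  "adj A f = (THE h. h \<in> H \<and> (\<forall>g\<in>H. ip (A g) f = ip g h))"

end

locale rkhs = hilbert_function_space +
  assumes eval_bounded: "\<And>x. x \<in> X \<Longrightarrow> \<exists>C. \<forall>f\<in>H. cmod (f x) \<le> C * hnorm f"
begin

definition kernel :: "'a \<Rightarrow> 'a \<Rightarrow> complex" where
  "kernel x = (THE k. k \<in> H \<and> (\<forall>f\<in>H. f x = ip f k))"

definition nkernel :: "'a \<Rightarrow> 'a \<Rightarrow> complex" where
  "nkernel x = (\<lambda>t. kernel x t / complex_of_real (hnorm (kernel x)))"

end

locale rkhs_nonzero = rkhs +
  assumes kernel_nonzero: "\<And>x. x \<in> X \<Longrightarrow> kernel x \<noteq> 0"
begin

definition ber :: "(('a \<Rightarrow> complex) \<Rightarrow> ('a \<Rightarrow> complex)) \<Rightarrow> real" where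
  "ber A = (SUP x\<in>X. cmod (ip (A (nkernel x)) (nkernel x)))"

definition ber_norm :: "(('a \<Rightarrow> complex) \<Rightarrow> ('a \<Rightarrow> complex)) \<Rightarrow> real" where
  "ber_norm A = (SUP (x, y)\<in>X \<times> X. cmod (ip (A (nkernel x)) (nkernel y)))"

end

end

theory Submission
  imports Defs
begin

text \<open>
  Write \<open>k\<close> and \<open>m\<close> for two normalised kernels. Expanding a square of a sum of two scalars gives
  \[ |\langle (A+B)k, m\rangle|^2 \le |\langle Ak,m\rangle|^2 + |\langle Bk,m\rangle|^2
       + 2\,|\langle Ak,m\rangle|\,|\langle m,Bk\rangle| . \]
  The first two terms are bounded by the squared Berezin norms of \<open>A\<close> and \<open>B\<close>. As \<open>m\<close> is a unit
  vector, Buzano's inequality (\<open>buzano\<close>) bounds the last term by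
  \<open>\<parallel>Ak\<parallel> \<parallel>Bk\<parallel> + |\<langle>Ak, Bk\<rangle>|\<close>, hence by \<open>(\<parallel>Ak\<parallel>\<^sup>2 + \<parallel>Bk\<parallel>\<^sup>2)/2 + |\<langle>Ak, Bk\<rangle>|\<close>. Moving the operators
  to one side, these two summands are the moduli at \<open>k\<close> of the Berezin symbols of
  \<open>(A\<^sup>*A + B\<^sup>*B)/2\<close> and \<open>A\<^sup>*B\<close>. The second inequality is the same argument with
  \<open>\<langle>Ak, m\<rangle> = \<langle>k, A\<^sup>*m\<rangle>\<close>, in which Buzano's inequality is applied to \<open>A\<^sup>*m\<close>, \<open>B\<^sup>*m\<close> and the unit
  vector \<open>k\<close>.

  Kernels and adjoints are given by definite descriptions, so they have their defining properties
  only because of the Riesz representation theorem (\<open>riesz_representation\<close>). It is proved here for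
  both scalar fields at once, by minimising \<open>\<parallel>f\<parallel>\<^sup>2 - 2 Re (\<phi> f)\<close> over the whole space.
\<close>

section \<open>Inner product geometry\<close>

context hilbert_function_space
begin

definition smul :: "complex \<Rightarrow> ('a \<Rightarrow> complex) \<Rightarrow> ('a \<Rightarrow> complex)" where
  "smul c f = (\<lambda>x. c * f x)"

lemma of_real_scalar [simp]: "complex_of_real r \<in> F"
  using scalars by auto

lemma neg_one_scalar [simp]: "- 1 \<in> F"
  using of_real_scalar[of "- 1"] by simp

lemma one_scalar [simp]: "1 \<in> F"
  using of_real_scalar[of 1] by simp

lemma smul_mem [simp]: "c \<in> F \<Longrightarrow> f \<in> H \<Longrightarrow> smul c f \<in> H"
  unfolding smul_def by (rule scale_mem)

lemma diff_eq_add_smul: "f - g = f + smul (- 1) g"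
  by (auto simp: smul_def)

lemma diff_mem [simp]: "f \<in> H \<Longrightarrow> g \<in> H \<Longrightarrow> f - g \<in> H"
  by (simp add: diff_eq_add_smul add_mem)

lemma ip_smul_left: "c \<in> F \<Longrightarrow> f \<in> H \<Longrightarrow> g \<in> H \<Longrightarrow> ip (smul c f) g = c * ip f g"
  unfolding smul_def by (rule ip_scale)

lemma ip_smul_right: "c \<in> F \<Longrightarrow> f \<in> H \<Longrightarrow> g \<in> H \<Longrightarrow> ip f (smul c g) = cnj c * ip f g"
  by (metis complex_cnj_mult ip_commute ip_smul_left smul_mem)

lemma ip_add_right: "f \<in> H \<Longrightarrow> g \<in> H \<Longrightarrow> h \<in> H \<Longrightarrow> ip f (g + h) = ip f g + ip f h"
  by (metis add_mem complex_cnj_add ip_add ip_commute)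

lemma ip_diff_right: "f \<in> H \<Longrightarrow> g \<in> H \<Longrightarrow> h \<in> H \<Longrightarrow> ip f (g - h) = ip f g - ip f h"
  by (simp add: diff_eq_add_smul ip_add_right ip_smul_right)

lemma hnorm_nonneg [simp]: "f \<in> H \<Longrightarrow> 0 \<le> hnorm f"
  by (simp add: hnorm_def ip_nonneg)

lemma ip_self: "f \<in> H \<Longrightarrow> ip f f = complex_of_real ((hnorm f)\<^sup>2)"
proof -
  assume f: "f \<in> H"
  have "Im (ip f f) = 0"
    using arg_cong[OF ip_commute[OF f f], of Im] by simp
  then show ?thesis
    using ip_nonneg[OF f] by (simp add: hnorm_def complex_eq_iff)
qed

lemma hnorm_eq_0: "f \<in> H \<Longrightarrow> hnorm f = 0 \<Longrightarrow> f = 0"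
  using ip_self ip_definite by simp

lemma hnorm_add_smul:
  assumes "c \<in> F" "f \<in> H" "g \<in> H"
  shows "(hnorm (f + smul c g))\<^sup>2 =
    (hnorm f)\<^sup>2 + 2 * Re (cnj c * ip f g) + (cmod c)\<^sup>2 * (hnorm g)\<^sup>2"
proof -
  have "complex_of_real ((hnorm (f + smul c g))\<^sup>2) = ip (f + smul c g) (f + smul c g)"
    using assms by (simp add: ip_self add_mem)
  also have "\<dots> = ip f f + (cnj c * ip f g + cnj (cnj c * ip f g)) + (c * cnj c) * ip g g"
    using assms by (simp add: ip_add ip_add_right ip_smul_left ip_smul_right add_mem
        ip_commute[of f g] algebra_simps)
  also have "\<dots> = complex_of_real
      ((hnorm f)\<^sup>2 + 2 * Re (cnj c * ip f g) + (cmod c)\<^sup>2 * (hnorm g)\<^sup>2)"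
    using assms by (simp only: complex_add_cnj complex_mult_cnj cmod_power2 ip_self of_real_add of_real_mult)
  finally show ?thesis
    by (simp only: of_real_eq_iff)
qed

lemma hnorm_smul:
  assumes "c \<in> F" "f \<in> H"
  shows "hnorm (smul c f) = cmod c * hnorm f"
proof -
  have "(hnorm (smul c f))\<^sup>2 = (cmod c * hnorm f)\<^sup>2"
    using hnorm_add_smul[OF assms(1) zero_mem assms(2)] ip_smul_left[of 0 f f] ip_smul_left[of 0 f 0]
      of_real_scalar[of 0] assms zero_mem
      ip_add[OF zero_mem zero_mem assms(2)]
      ip_add[OF zero_mem zero_mem zero_mem]
    by (simp add: hnorm_def power_mult_distrib)
  then show ?thesis
    using assms by (simp add: power2_eq_iff_nonneg)
qed

lemma cauchy_schwarz:
  assumes f: "f \<in> H" and g: "g \<in> H"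
  shows "cmod (ip f g) \<le> hnorm f * hnorm g"
proof (cases "hnorm g = 0")
  case True
  then have "g = 0"
    using g by (rule hnorm_eq_0[rotated])
  then have "ip f g = 0"
    using ip_add_right[OF f zero_mem zero_mem] by simp
  then show ?thesis
    using f g by simp
next
  case False
  \<comment> \<open>A multiple of the component of \<open>f\<close> orthogonal to \<open>g\<close>, scaled so that no division in the scalar
    set occurs.\<close>
  define h where "h = smul (complex_of_real ((hnorm g)\<^sup>2)) f + smul (- ip f g) g"
  have neg: "- ip f g \<in> F"
    using ip_mem[OF f g] scalars by auto
  have "(hnorm h)\<^sup>2 = (hnorm g)\<^sup>2 * ((hnorm f)\<^sup>2 * (hnorm g)\<^sup>2 - (cmod (ip f g))\<^sup>2)"
    unfolding h_def
    using f g neg by (simp add: hnorm_add_smul hnorm_smul ip_smul_left cmod_power2 del: of_real_power)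
      (simp add: algebra_simps power2_eq_square)
  then have "0 \<le> (hnorm g)\<^sup>2 * ((hnorm f)\<^sup>2 * (hnorm g)\<^sup>2 - (cmod (ip f g))\<^sup>2)"
    by (metis zero_le_power2)
  then have "(cmod (ip f g))\<^sup>2 \<le> (hnorm f * hnorm g)\<^sup>2"
    using False by (simp add: zero_le_mult_iff power_mult_distrib)
  then show ?thesis
    using f g by (simp add: power2_le_iff_abs_le)
qed

text \<open>
  The map \<open>a \<mapsto> 2\<langle>a,e\<rangle>e - a\<close> is the reflection in the line of the unit vector \<open>e\<close>, hence isometric.
  Cauchy--Schwarz for the reflected vector and \<open>b\<close> bounds \<open>2\<langle>a,e\<rangle>\<langle>e,b\<rangle> - \<langle>a,b\<rangle>\<close>.
\<close>

lemma buzano: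
  assumes a: "a \<in> H" and b: "b \<in> H" and e: "e \<in> H" and unit: "hnorm e = 1"
  shows "2 * (cmod (ip a e) * cmod (ip b e)) \<le> hnorm a * hnorm b + cmod (ip a b)"
proof -
  define c where "c = - 2 * ip a e"
  have c: "c \<in> F"
    using ip_mem[OF a e] scalars by (auto simp: c_def)
  define r where "r = a + smul c e"
  have r: "r \<in> H"
    using a c e by (simp add: r_def add_mem)
  have "(hnorm r)\<^sup>2 = (hnorm a)\<^sup>2"
    using a c e unit
    by (simp add: r_def hnorm_add_smul c_def norm_mult power_mult_distrib cmod_power2)
      (simp add: algebra_simps power2_eq_square)
  then have "hnorm r = hnorm a"
    using a r by (simp add: power2_eq_iff_nonneg)
  then have "cmod (ip r b) \<le> hnorm a * hnorm b"
    using cauchy_schwarz[OF r b] by simp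
  moreover have "ip r b = ip a b - 2 * (ip a e * ip e b)"
    using a b c e by (simp add: r_def ip_add ip_smul_left c_def)
  moreover have "cmod (2 * (ip a e * ip e b)) \<le> cmod (ip a b) + cmod (ip a b - 2 * (ip a e * ip e b))"
    using norm_triangle_ineq4[of "ip a b" "ip a b - 2 * (ip a e * ip e b)"] by simp
  moreover have "cmod (ip e b) = cmod (ip b e)"
    using ip_commute[OF b e] by simp
  ultimately show ?thesis
    by (simp add: norm_mult)
qed

lemma hnorm_parallelogram:
  assumes "f \<in> H" "g \<in> H"
  shows "(hnorm (f - g))\<^sup>2 + (hnorm (f + g))\<^sup>2 = 2 * (hnorm f)\<^sup>2 + 2 * (hnorm g)\<^sup>2"
  using hnorm_add_smul[of "- 1" f g] hnorm_add_smul[of 1 f g] assms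
  by (simp add: diff_eq_add_smul) (simp add: smul_def)

lemma eq_if_ip_eq:
  assumes "g \<in> H" "h \<in> H" "\<And>f. f \<in> H \<Longrightarrow> ip f g = ip f h"
  shows "g = h"
proof -
  have "ip (g - h) (g - h) = 0"
    using assms by (simp add: ip_diff_right)
  then have "g - h = 0"
    using assms by (intro ip_definite) auto
  then show ?thesis
    by simp
qed

section \<open>Riesz representation and adjoints\<close>

text \<open>
  If \<open>h\<close> represents \<open>\<phi>\<close>, then \<open>\<parallel>f\<parallel>\<^sup>2 - 2 Re (\<phi> f) = \<parallel>f - h\<parallel>\<^sup>2 - \<parallel>h\<parallel>\<^sup>2\<close>, so \<open>h\<close> must be the minimiser of
  the left-hand side. Conversely, the parallelogram law makes every minimising sequence Cauchy, and
  the approximate first-order conditions along it give, in the limit, that its limit represents the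
  real part of \<open>\<phi>\<close>.
  The imaginary part is either absent or is reached through multiplication by \<open>\<i>\<close>.
\<close>

lemma riesz_representation:
  assumes val: "\<And>f. f \<in> H \<Longrightarrow> \<phi> f \<in> F"
    and add: "\<And>f g. f \<in> H \<Longrightarrow> g \<in> H \<Longrightarrow> \<phi> (f + g) = \<phi> f + \<phi> g"
    and scale: "\<And>c f. c \<in> F \<Longrightarrow> f \<in> H \<Longrightarrow> \<phi> (smul c f) = c * \<phi> f"
    and bound: "\<And>f. f \<in> H \<Longrightarrow> cmod (\<phi> f) \<le> C * hnorm f"
  shows "\<exists>!h. h \<in> H \<and> (\<forall>f\<in>H. \<phi> f = ip f h)"
proof -
  define J where "J f = (hnorm f)\<^sup>2 - 2 * Re (\<phi> f)" for f
  define m where "m = (INF f\<in>H. J f)"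
  have "- C\<^sup>2 \<le> J f" if f: "f \<in> H" for f
  proof -
    have "Re (\<phi> f) \<le> C * hnorm f"
      using bound[OF f] complex_Re_le_cmod[of "\<phi> f"] by linarith
    moreover have "0 \<le> (hnorm f - C)\<^sup>2"
      by simp
    ultimately show ?thesis
      by (simp add: J_def power2_diff algebra_simps)
  qed
  then have bdd: "bdd_below (J ` H)"
    by (intro bdd_belowI[of _ "- C\<^sup>2"]) auto
  have m_le: "m \<le> J f" if "f \<in> H" for f
    unfolding m_def using bdd that by (rule cINF_lower)
  define e where "e n = inverse (real (Suc n))" for n
  have e_lim: "e \<longlonglongrightarrow> 0"
    unfolding e_def by (rule LIMSEQ_inverse_real_of_nat)
  have "\<exists>f\<in>H. J f < m + e n" for n
  proof -
    have "m < m + e n"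
      by (simp add: e_def)
    then show ?thesis
      unfolding m_def using cINF_less_iff[of H J] zero_mem bdd by blast
  qed
  then obtain u where u: "\<And>n. u n \<in> H" and Ju: "\<And>n. J (u n) < m + e n"
    by metis
  have dist_u: "(hnorm (u i - u j))\<^sup>2 \<le> 2 * e i + 2 * e j" for i j
  proof -
    define s where "s = smul (complex_of_real (1 / 2)) (u i + u j)"
    have "J s = (hnorm (u i + u j))\<^sup>2 / 4 - Re (\<phi> (u i)) - Re (\<phi> (u j))"
      unfolding s_def J_def using u
      by (simp add: scale add hnorm_smul add_mem power_mult_distrib power_divide field_simps del: of_real_divide)
    moreover have "m \<le> J s"
      by (intro m_le) (simp add: s_def add_mem u del: of_real_divide)
    ultimately show ?thesis
      using hnorm_parallelogram[OF u[of i] u[of j]] Ju[of i] Ju[of j] by (simp add: J_def)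
  qed
  have cauchy: "\<exists>N. \<forall>i\<ge>N. \<forall>j\<ge>N. sqrt (Re (ip (u i - u j) (u i - u j))) < d" if d: "d > 0" for d
  proof -
    obtain N where N: "\<And>n. n \<ge> N \<Longrightarrow> e n < d\<^sup>2 / 4"
      using order_tendstoD(2)[OF e_lim, of "d\<^sup>2 / 4"] d by (auto simp: eventually_sequentially)
    have "hnorm (u i - u j) < d" if "i \<ge> N" "j \<ge> N" for i j
      using dist_u[of i j] N[OF that(1)] N[OF that(2)] d
      by (intro power_less_imp_less_base[of _ 2 d]) linarith+
    then show ?thesis
      by (auto simp: hnorm_def)
  qed
  obtain h where h: "h \<in> H" and lim: "(\<lambda>n. hnorm (u n - h)) \<longlonglongrightarrow> 0"
    using complete[of u, OF u cauchy] unfolding hnorm_def by blast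
  have Re_eq: "Re (\<phi> f) = Re (ip f h)" if f: "f \<in> H" for f
  proof -
    \<comment> \<open>Approximate first-order condition: moving from \<open>u n\<close> along \<open>f\<close> lowers \<open>J\<close> by at most \<open>e n\<close>, and
      the best step is minus half the derivative divided by \<open>\<parallel>f\<parallel>\<^sup>2\<close>.\<close>
    have step: "(Re (ip f (u n)) - Re (\<phi> f))\<^sup>2 \<le> e n * (hnorm f)\<^sup>2" for n
    proof (cases "hnorm f = 0")
      case True
      then have "f = 0"
        using f by (rule hnorm_eq_0[rotated])
      then show ?thesis
        using add[OF zero_mem zero_mem] ip_add[OF zero_mem zero_mem u[of n]] by (simp add: e_def)
    next
      case False
      define d where "d = Re (ip f (u n)) - Re (\<phi> f)"
      define t where "t = - d / (hnorm f)\<^sup>2"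
      have "m \<le> J (u n + smul (complex_of_real t) f)"
        by (intro m_le) (simp add: add_mem u f)
      also have "\<dots> = J (u n) + (2 * t * d + t\<^sup>2 * (hnorm f)\<^sup>2)"
        unfolding J_def d_def using u[of n] f
        by (simp add: hnorm_add_smul add scale ip_commute[of f "u n"] algebra_simps)
      also have "2 * t * d + t\<^sup>2 * (hnorm f)\<^sup>2 = - (d\<^sup>2 / (hnorm f)\<^sup>2)"
        using False by (simp add: t_def field_simps power2_eq_square)
      finally have "d\<^sup>2 / (hnorm f)\<^sup>2 \<le> e n"
        using Ju[of n] by simp
      then show ?thesis
        using False by (simp add: d_def divide_le_eq)
    qed
    have "(\<lambda>n. (Re (ip f (u n)) - Re (\<phi> f))\<^sup>2) \<longlonglongrightarrow> 0"
      by (rule tendsto_sandwich[OF _ _ tendsto_const tendsto_mult_left_zero[OF e_lim]])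
        (auto intro: always_eventually step)
    then have "(\<lambda>n. Re (ip f (u n)) - Re (\<phi> f)) \<longlonglongrightarrow> 0"
      by simp
    moreover have "(\<lambda>n. Re (ip f (u n)) - Re (ip f h)) \<longlonglongrightarrow> 0"
    proof (rule tendsto_0_le[OF lim always_eventually, where K = "hnorm f"], intro allI)
      fix n
      have "\<bar>Re (ip f (u n - h))\<bar> \<le> hnorm f * hnorm (u n - h)"
        using abs_Re_le_cmod[of "ip f (u n - h)"] cauchy_schwarz[of f "u n - h"] f u h by fastforce
      then show "norm (Re (ip f (u n)) - Re (ip f h)) \<le> norm (hnorm (u n - h)) * hnorm f"
        using f u h by (simp add: ip_diff_right mult.commute)
    qed
    ultimately show ?thesis
      using LIMSEQ_unique tendsto_diff by fastforce
  qed
  have "\<phi> f = ip f h" if f: "f \<in> H" for f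
  proof (rule complex_eqI)
    show "Re (\<phi> f) = Re (ip f h)"
      by (rule Re_eq[OF f])
    show "Im (\<phi> f) = Im (ip f h)"
      using scalars
    proof
      assume "F = \<real>"
      then show ?thesis
        using val[OF f] ip_mem[OF f h] by (simp add: complex_is_Real_iff)
    next
      assume "F = UNIV"
      then have "Re (\<i> * \<phi> f) = Re (\<i> * ip f h)"
        using Re_eq[of "smul \<i> f"] f h by (simp only: scale ip_smul_left smul_mem UNIV_I)
      then show ?thesis
        by simp
    qed
  qed
  then show ?thesis
    using h eq_if_ip_eq by (intro ex1I[of _ h]) metis+
qed

lemma bounded_op_mem: "A \<in> bounded_ops \<Longrightarrow> f \<in> H \<Longrightarrow> A f \<in> H"
  by (simp add: bounded_ops_def)

lemma bounded_op_bound: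
  assumes "A \<in> bounded_ops"
  obtains C where "0 \<le> C" "\<And>f. f \<in> H \<Longrightarrow> hnorm (A f) \<le> C * hnorm f"
proof -
  obtain C where C: "\<And>f. f \<in> H \<Longrightarrow> hnorm (A f) \<le> C * hnorm f"
    using assms unfolding bounded_ops_def by blast
  have "hnorm (A f) \<le> \<bar>C\<bar> * hnorm f" if "f \<in> H" for f
    using C[OF that] mult_right_mono[OF abs_ge_self[of C] hnorm_nonneg[OF that]] by linarith
  then show ?thesis
    using that[of "\<bar>C\<bar>"] by simp
qed

lemma
  assumes A: "A \<in> bounded_ops" and f: "f \<in> H"
  shows adj_mem: "adj A f \<in> H"
    and ip_adj_right: "g \<in> H \<Longrightarrow> ip g (adj A f) = ip (A g) f"
proof -
  obtain C where C: "0 \<le> C" "\<And>g. g \<in> H \<Longrightarrow> hnorm (A g) \<le> C * hnorm g"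
    using bounded_op_bound[OF A] by blast
  have "\<exists>!h. h \<in> H \<and> (\<forall>g\<in>H. ip (A g) f = ip g h)"
  proof (rule riesz_representation[where C = "C * hnorm f"])
    show "ip (A g) f \<in> F" if "g \<in> H" for g
      using that A f by (simp add: ip_mem bounded_op_mem)
    show "ip (A (g + h)) f = ip (A g) f + ip (A h) f" if "g \<in> H" "h \<in> H" for g h
      using that A f by (simp add: bounded_ops_def ip_add)
    show "ip (A (smul c g)) f = c * ip (A g) f" if "c \<in> F" "g \<in> H" for c g
      using that A f by (simp add: bounded_ops_def smul_def ip_scale)
    show "cmod (ip (A g) f) \<le> C * hnorm f * hnorm g" if g: "g \<in> H" for g
      using cauchy_schwarz[OF bounded_op_mem[OF A g] f]
        mult_right_mono[OF C(2)[OF g] hnorm_nonneg[OF f]]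
      by (simp add: mult_ac)
  qed
  from theI'[OF this] show "adj A f \<in> H" "g \<in> H \<Longrightarrow> ip g (adj A f) = ip (A g) f"
    unfolding adj_def by auto
qed

lemma ip_adj_left:
  assumes "A \<in> bounded_ops" "f \<in> H" "g \<in> H"
  shows "ip (adj A f) g = ip f (A g)"
  using assms by (metis adj_mem bounded_op_mem ip_adj_right ip_commute)

text \<open>Testing \<open>\<parallel>A\<^sup>*f\<parallel>\<^sup>2 = \<langle>AA\<^sup>*f, f\<rangle>\<close> against the bound for \<open>A\<close> lets one factor \<open>\<parallel>A\<^sup>*f\<parallel>\<close> cancel.\<close>

lemma hnorm_adj_le:
  assumes A: "A \<in> bounded_ops" and f: "f \<in> H" and C: "0 \<le> C"
    and bound: "\<And>f. f \<in> H \<Longrightarrow> hnorm (A f) \<le> C * hnorm f"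
  shows "hnorm (adj A f) \<le> C * hnorm f"
proof (cases "hnorm (adj A f) = 0")
  case False
  note mem = adj_mem[OF A f]
  have "(hnorm (adj A f))\<^sup>2 = cmod (ip (A (adj A f)) f)"
    using ip_self[OF mem] ip_adj_right[OF A f mem] by (simp add: norm_power)
  also have "\<dots> \<le> C * hnorm (adj A f) * hnorm f"
    using cauchy_schwarz[OF bounded_op_mem[OF A mem] f]
      mult_right_mono[OF bound[OF mem] hnorm_nonneg[OF f]] by linarith
  finally have "hnorm (adj A f) * hnorm (adj A f) \<le> hnorm (adj A f) * (C * hnorm f)"
    by (simp add: power2_eq_square mult_ac)
  then show ?thesis
    using False hnorm_nonneg[OF mem] by (simp add: mult_le_cancel_left)
qed (use C f in simp)

text \<open>
  Buzano's inequality after expanding the square; the vectors \<open>a\<close> and \<open>b\<close> will be the images of a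
  unit vector under two operators, or under their adjoints.
\<close>

lemma cmod_ip_add_square_le:
  assumes a: "a \<in> H" and b: "b \<in> H" and e: "e \<in> H" and unit: "hnorm e = 1"
  shows "(cmod (ip (a + b) e))\<^sup>2 \<le> (cmod (ip a e))\<^sup>2 + (cmod (ip b e))\<^sup>2
    + 1 / 2 * cmod (ip a a + ip b b) + cmod (ip b a)"
proof -
  have "(cmod (ip (a + b) e))\<^sup>2 \<le> (cmod (ip a e) + cmod (ip b e))\<^sup>2"
    using a b e by (simp add: ip_add norm_triangle_ineq power_mono)
  also have "\<dots> = (cmod (ip a e))\<^sup>2 + (cmod (ip b e))\<^sup>2 + 2 * (cmod (ip a e) * cmod (ip b e))"
    by (simp add: power2_sum)
  also have "2 * (cmod (ip a e) * cmod (ip b e)) \<le> hnorm a * hnorm b + cmod (ip a b)"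
    by (rule buzano[OF a b e unit])
  finally have "(cmod (ip (a + b) e))\<^sup>2 \<le>
      (cmod (ip a e))\<^sup>2 + (cmod (ip b e))\<^sup>2 + (hnorm a * hnorm b + cmod (ip a b))"
    by simp
  moreover have "ip a a + ip b b = complex_of_real ((hnorm a)\<^sup>2 + (hnorm b)\<^sup>2)"
    using a b by (simp add: ip_self)
  then have "cmod (ip a a + ip b b) = (hnorm a)\<^sup>2 + (hnorm b)\<^sup>2"
    by (simp only: norm_of_real) simp
  moreover have "2 * (hnorm a * hnorm b) \<le> (hnorm a)\<^sup>2 + (hnorm b)\<^sup>2"
    using sum_squares_bound[of "hnorm a" "hnorm b"] by simp
  moreover have "cmod (ip b a) = cmod (ip a b)"
    using ip_commute[OF a b] by simp
  ultimately show ?thesis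
    by linarith
qed

end

section \<open>Normalised kernels and Berezin suprema\<close>

context rkhs
begin

lemma kernel_mem: "x \<in> X \<Longrightarrow> kernel x \<in> H"
proof -
  assume x: "x \<in> X"
  obtain C where "\<And>f. f \<in> H \<Longrightarrow> cmod (f x) \<le> C * hnorm f"
    using eval_bounded[OF x] by blast
  then have "\<exists>!k. k \<in> H \<and> (\<forall>f\<in>H. f x = ip f k)"
    by (intro riesz_representation[where \<phi> = "\<lambda>f. f x"]) (auto simp: scalar_valued x smul_def)
  from theI'[OF this] show ?thesis
    unfolding kernel_def by blast
qed

end

context rkhs_nonzero
begin

lemma
  assumes "x \<in> X"
  shows nkernel_mem: "nkernel x \<in> H" and hnorm_nkernel: "hnorm (nkernel x) = 1"
proof -
  have eq: "nkernel x = smul (complex_of_real (1 / hnorm (kernel x))) (kernel x)"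
    by (simp add: nkernel_def smul_def fun_eq_iff)
  have "hnorm (kernel x) \<noteq> 0"
    using kernel_nonzero[OF assms] hnorm_eq_0[OF kernel_mem[OF assms]] by blast
  then show "nkernel x \<in> H" "hnorm (nkernel x) = 1"
    using kernel_mem[OF assms] unfolding eq by (auto simp: hnorm_smul simp del: of_real_divide)
qed

text \<open>
  The supremum of an unbounded set of reals is an unspecified value, hence the uniform bound \<open>K\<close>.
\<close>

lemma cmod_le_ber:
  assumes "\<And>x. x \<in> X \<Longrightarrow> cmod (ip (T (nkernel x)) (nkernel x)) \<le> K" and "x \<in> X"
  shows "cmod (ip (T (nkernel x)) (nkernel x)) \<le> ber T"
  unfolding ber_def using assms by (intro cSUP_upper bdd_aboveI2[where M = K]) auto

lemma cmod_le_ber_norm: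
  assumes A: "A \<in> bounded_ops" and x: "x \<in> X" and y: "y \<in> X"
  shows "cmod (ip (A (nkernel x)) (nkernel y)) \<le> ber_norm A"
proof -
  obtain C where C: "0 \<le> C" "\<And>f. f \<in> H \<Longrightarrow> hnorm (A f) \<le> C * hnorm f"
    using bounded_op_bound[OF A] by blast
  have "cmod (ip (A (nkernel x)) (nkernel y)) \<le> C" if "x \<in> X" "y \<in> X" for x y
    using cauchy_schwarz[of "A (nkernel x)" "nkernel y"] C(2)[of "nkernel x"] that
    by (simp add: nkernel_mem hnorm_nkernel bounded_op_mem A)
  then have "bdd_above ((\<lambda>(x, y). cmod (ip (A (nkernel x)) (nkernel y))) ` (X \<times> X))"
    by (intro bdd_aboveI2[where M = C]) auto
  from cSUP_upper[OF _ this, of "(x, y)"] show ?thesis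
    unfolding ber_norm_def using x y by simp
qed

lemma ber_norm_square_le:
  assumes "\<And>x y. x \<in> X \<Longrightarrow> y \<in> X \<Longrightarrow> (cmod (ip (T (nkernel x)) (nkernel y)))\<^sup>2 \<le> R"
  shows "(ber_norm T)\<^sup>2 \<le> R"
proof -
  obtain x where x: "x \<in> X"
    using nonempty by blast
  have le: "ber_norm T \<le> sqrt R"
    unfolding ber_norm_def using nonempty assms by (intro cSUP_least) (auto intro: real_le_rsqrt)
  have bdd: "bdd_above ((\<lambda>(x, y). cmod (ip (T (nkernel x)) (nkernel y))) ` (X \<times> X))"
    using assms by (intro bdd_aboveI2[where M = "sqrt R"]) (auto intro: real_le_rsqrt)
  have "0 \<le> cmod (ip (T (nkernel x)) (nkernel x))"
    by simp
  also have "\<dots> \<le> ber_norm T"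
    unfolding ber_norm_def using cSUP_upper[OF _ bdd, of "(x, x)"] x by simp
  finally have "0 \<le> ber_norm T" .
  moreover have "0 \<le> R"
    using assms[OF x x] zero_le_power2 order_trans by blast
  ultimately show ?thesis
    using power_mono[OF le, of 2] by simp
qed

text \<open>
  Both inequalities of the theorem are instances: \<open>P\<close>, \<open>Q\<close> are \<open>A\<close>, \<open>B\<close> or their adjoints, and \<open>S\<close>,
  \<open>T\<close> are the operators whose symbols are \<open>\<parallel>Pk\<parallel>\<^sup>2 + \<parallel>Qk\<parallel>\<^sup>2\<close> and \<open>\<langle>Qk, Pk\<rangle>\<close> at a normalised kernel \<open>k\<close>.
\<close>

lemma cmod_ip_nkernel_square_le:
  assumes mem: "\<And>f. f \<in> H \<Longrightarrow> P f \<in> H" "\<And>f. f \<in> H \<Longrightarrow> Q f \<in> H"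
    and P: "\<And>f. f \<in> H \<Longrightarrow> hnorm (P f) \<le> C * hnorm f"
    and Q: "\<And>f. f \<in> H \<Longrightarrow> hnorm (Q f) \<le> D * hnorm f"
    and S: "\<And>f. f \<in> H \<Longrightarrow> ip (S f) f = ip (P f) (P f) + ip (Q f) (Q f)"
    and T: "\<And>f. f \<in> H \<Longrightarrow> ip (T f) f = ip (Q f) (P f)"
    and x: "x \<in> X" and e: "e \<in> H" "hnorm e = 1"
  shows "(cmod (ip (P (nkernel x) + Q (nkernel x)) e))\<^sup>2 \<le>
    (cmod (ip (P (nkernel x)) e))\<^sup>2 + (cmod (ip (Q (nkernel x)) e))\<^sup>2 + 1 / 2 * ber S + ber T"
proof -
  have ip_le: "cmod (ip f g) \<le> c * d"
    if "f \<in> H" "g \<in> H" "hnorm f \<le> c" "hnorm g \<le> d" for f g c d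
    using cauchy_schwarz[OF that(1,2)] mult_mono'[OF that(3,4)] that(1,2) by fastforce
  have bounds: "hnorm (P (nkernel z)) \<le> C" "hnorm (Q (nkernel z)) \<le> D" if "z \<in> X" for z
    using P[OF nkernel_mem[OF that]] Q[OF nkernel_mem[OF that]] hnorm_nkernel[OF that] by simp_all
  have "cmod (ip (S (nkernel z)) (nkernel z)) \<le> C * C + D * D" if "z \<in> X" for z
    unfolding S[OF nkernel_mem[OF that]]
    by (intro norm_triangle_mono ip_le mem nkernel_mem bounds that)
  then have "cmod (ip (S (nkernel x)) (nkernel x)) \<le> ber S"
    using x by (rule cmod_le_ber)
  moreover have "cmod (ip (T (nkernel z)) (nkernel z)) \<le> D * C" if "z \<in> X" for z
    unfolding T[OF nkernel_mem[OF that]]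
    by (intro ip_le mem nkernel_mem bounds that)
  then have "cmod (ip (T (nkernel x)) (nkernel x)) \<le> ber T"
    using x by (rule cmod_le_ber)
  ultimately show ?thesis
    using cmod_ip_add_square_le[OF mem(1)[OF nkernel_mem[OF x]] mem(2)[OF nkernel_mem[OF x]] e]
    by (simp add: S T nkernel_mem x)
qed

end

section \<open>The two inequalities\<close>

theorem theorem3p3:
  fixes F :: "complex set"
    and X :: "'a set"
    and H :: "('a \<Rightarrow> complex) set"
    and ip :: "('a \<Rightarrow> complex) \<Rightarrow> ('a \<Rightarrow> complex) \<Rightarrow> complex"
    and A B :: "('a \<Rightarrow> complex) \<Rightarrow> ('a \<Rightarrow> complex)"
  assumes "rkhs_nonzero F X H ip"
    and "A \<in> hilbert_function_space.bounded_ops F H ip"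
    and "B \<in> hilbert_function_space.bounded_ops F H ip"
  shows "(rkhs_nonzero.ber_norm X H ip (A + B))\<^sup>2
           \<le> (rkhs_nonzero.ber_norm X H ip A)\<^sup>2 + (rkhs_nonzero.ber_norm X H ip B)\<^sup>2
             + 1 / 2 * rkhs_nonzero.ber X H ip
                 ((hilbert_function_space.adj H ip A \<circ> A) + (hilbert_function_space.adj H ip B \<circ> B))
             + rkhs_nonzero.ber X H ip (hilbert_function_space.adj H ip A \<circ> B)
       \<and> (rkhs_nonzero.ber_norm X H ip (A + B))\<^sup>2
           \<le> (rkhs_nonzero.ber_norm X H ip A)\<^sup>2 + (rkhs_nonzero.ber_norm X H ip B)\<^sup>2
             + 1 / 2 * rkhs_nonzero.ber X H ip
                 ((A \<circ> hilbert_function_space.adj H ip A) + (B \<circ> hilbert_function_space.adj H ip B))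
             + rkhs_nonzero.ber X H ip (A \<circ> hilbert_function_space.adj H ip B)"
proof -
  interpret rkhs_nonzero F X H ip
    by (rule assms(1))
  note A = assms(2) and B = assms(3)
  obtain C where C: "0 \<le> C" "\<And>f. f \<in> H \<Longrightarrow> hnorm (A f) \<le> C * hnorm f"
    using bounded_op_bound[OF A] by blast
  obtain D where D: "0 \<le> D" "\<And>f. f \<in> H \<Longrightarrow> hnorm (B f) \<le> D * hnorm f"
    using bounded_op_bound[OF B] by blast
  note mem = bounded_op_mem[OF A] bounded_op_mem[OF B] adj_mem[OF A] adj_mem[OF B]
  have norm_le: "(cmod (ip (A (nkernel x)) (nkernel y)))\<^sup>2 \<le> (ber_norm A)\<^sup>2"
    "(cmod (ip (B (nkernel x)) (nkernel y)))\<^sup>2 \<le> (ber_norm B)\<^sup>2" if "x \<in> X" "y \<in> X" for x y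
    using that A B by (auto intro!: power_mono cmod_le_ber_norm)
  show ?thesis
  proof (intro conjI ber_norm_square_le)
    fix x y assume x: "x \<in> X" and y: "y \<in> X"
    have "(cmod (ip (A (nkernel x) + B (nkernel x)) (nkernel y)))\<^sup>2
        \<le> (cmod (ip (A (nkernel x)) (nkernel y)))\<^sup>2 + (cmod (ip (B (nkernel x)) (nkernel y)))\<^sup>2
          + 1 / 2 * ber ((adj A \<circ> A) + (adj B \<circ> B)) + ber (adj A \<circ> B)"
      by (rule cmod_ip_nkernel_square_le[OF _ _ C(2) D(2)])
        (simp_all add: mem ip_add ip_adj_left A B x y nkernel_mem hnorm_nkernel)
    then show "(cmod (ip ((A + B) (nkernel x)) (nkernel y)))\<^sup>2
        \<le> (ber_norm A)\<^sup>2 + (ber_norm B)\<^sup>2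
          + 1 / 2 * ber ((adj A \<circ> A) + (adj B \<circ> B)) + ber (adj A \<circ> B)"
      using norm_le[OF x y] by simp
  next
    fix x y assume x: "x \<in> X" and y: "y \<in> X"
    have swap: "cmod (ip (adj A (nkernel y)) (nkernel x)) = cmod (ip (A (nkernel x)) (nkernel y))"
      "cmod (ip (adj B (nkernel y)) (nkernel x)) = cmod (ip (B (nkernel x)) (nkernel y))"
      "cmod (ip (adj A (nkernel y) + adj B (nkernel y)) (nkernel x))
        = cmod (ip ((A + B) (nkernel x)) (nkernel y))"
      using nkernel_mem[OF x] nkernel_mem[OF y] mem
        ip_commute[of "A (nkernel x)" "nkernel y"] ip_commute[of "B (nkernel x)" "nkernel y"]
        ip_commute[of "A (nkernel x) + B (nkernel x)" "nkernel y"]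
      by (simp_all add: ip_adj_left A B ip_add ip_add_right add_mem flip: complex_cnj_add)
    have "(cmod (ip (adj A (nkernel y) + adj B (nkernel y)) (nkernel x)))\<^sup>2
        \<le> (cmod (ip (adj A (nkernel y)) (nkernel x)))\<^sup>2 + (cmod (ip (adj B (nkernel y)) (nkernel x)))\<^sup>2
          + 1 / 2 * ber ((A \<circ> adj A) + (B \<circ> adj B)) + ber (A \<circ> adj B)"
      by (rule cmod_ip_nkernel_square_le[OF _ _ hnorm_adj_le[OF A _ C] hnorm_adj_le[OF B _ D]])
        (simp_all add: mem ip_add ip_adj_right A B x y nkernel_mem hnorm_nkernel)
    then show "(cmod (ip ((A + B) (nkernel x)) (nkernel y)))\<^sup>2
        \<le> (ber_norm A)\<^sup>2 + (ber_norm B)\<^sup>2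
          + 1 / 2 * ber ((A \<circ> adj A) + (B \<circ> adj B)) + ber (A \<circ> adj B)"
      using norm_le[OF x y] unfolding swap by simp
  qed
qed

end
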